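(* Let $\pi_1:(P_1,\Sigma_1)\to(Q,\Sigma)$ and $\pi_2:(P_2,\Sigma_2)\to(Q,\Sigma)$ be morphisms in the category $\mathcal{P}$, where $\Sigma_1$ and $\Sigma_2$ take distinct values on distinct lattice points of $P_1$, respectively $P_2$. If the presenting ideals $I_{P_1}$, $I_{P_2}$, $I_Q$ of $(P_1,\Sigma_1)$, $(P_2,\Sigma_2)$, $(Q,\Sigma)$ all have quadratic, square-free Gröbner bases with respect to their term orders, then so does the presenting ideal of $(P_1,\Sigma_1)\boxtimes_{(Q,\Sigma)}(P_2,\Sigma_2)$ with respect to its term order.
   Context: For a lattice polytope $P\subset\mathbb{R}^n$, $X_P$ is its set of lattice points, $\mathbb{C}[X_P]$ is the polynomial ring with one variable per lattice point, $mP$ is the $m$-fold Minkowski sum, and $\mathbb{C}[P]$ is the graded algebra whose $m$-th graded component has as basis the lattice points of $mP$, with product given by addition. The presenting ideal $I_P$ is the kernel of $\mathbb{C}[X_P]\to\mathbb{C}[P]$. A term order on $P$ is a function $\Sigma:X_P\to\mathbb{R}$, extended to monomials by $\Sigma(\mathbf m)=\sum_i m_i\Sigma(x_i)$; monomials are ordered first by degree and then by $\Sigma$-value. The initial form of a polynomial is the sum of its terms that are largest in this order. A monomial is standard if it is not the initial form of any polynomial in $I_P$. The category $\mathcal{P}$ has as objects pairs $(P,\Sigma)$ of a lattice polytope and a term order on it; a morphism $\pi:(P,\Sigma)\to(Q,\Gamma)$ is a linear map $P\to Q$, induced by a map on lattices, taking standard monomials of $\Sigma$ to standard monomials of $\Gamma$.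 $I_P$ has a quadratic, square-free Gröbner basis with respect to an order if there is a set of degree $2$ polynomials in $I_P$ whose initial forms are (up to scalar) square-free monomials generating the ideal of all initial forms of elements of $I_P$. $(P_1,\Sigma_1)\boxtimes_{(Q,\Sigma)}(P_2,\Sigma_2)$ is the fiber product polytope $P_1\times_QP_2=\{(V,W)\in P_1\times P_2:\pi_1(V)=\pi_2(W)\}$ with the following order on monomials in its lattice points. For lattice points, $(V_1,W_1)<(V_2,W_2)$ if $\Sigma_1(V_1)<\Sigma_1(V_2)$, or if $\Sigma_1(V_1)=\Sigma_1(V_2)$ and $\Sigma_2(W_1)<\Sigma_2(W_2)$. Monomials are ordered first by degree, then by the weight $(\Sigma_1\oplus\Sigma_2)(V,W)=\Sigma_1(V)+\Sigma_2(W)$ (summed over factors); remaining ties are broken by writing the factors of both monomials in decreasing order and declaring $(V_1,W_1)\cdots(V_k,W_k)>(U_1,Y_1)\cdots(U_k,Y_k)$ if $(V_i,W_i)>(U_i,Y_i)$ at the first place $i$ where they differ. *)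

theory Defs
  imports "HOL-Analysis.Analysis" "HOL-Library.Poly_Mapping" "HOL-Library.Multiset"
begin

definition int_lattice :: "'a::euclidean_space set" where
  "int_lattice = {x. \<forall>b\<in>Basis. x \<bullet> b \<in> \<int>}"

definition lattice_polytope :: "'a::euclidean_space set \<Rightarrow> bool" where
  "lattice_polytope P \<longleftrightarrow> (\<exists>V. finite V \<and> V \<subseteq> int_lattice \<and> P = convex hull V)"

definition lattice_points :: "'a::euclidean_space set \<Rightarrow> 'a set" where
  "lattice_points P = P \<inter> int_lattice"

definition minkowski_multiple :: "nat \<Rightarrow> 'a::euclidean_space set \<Rightarrow> 'a set" where
  "minkowski_multiple m P = {\<Sum>i<m. x i | x. \<forall>i<m. x i \<in> P}"

text \<open>
  A monomial is the multiset of its factors, and a polynomial is a finitely supported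
  function from monomials to complex numbers; the product of \<open>Poly_Mapping\<close> is the
  convolution product. All elements of the type \<open>'a\<close> are available as variables, so the
  ring in the variables \<open>X\<close> is carved out as a subring.
\<close>

definition poly_ring :: "'a set \<Rightarrow> ('a multiset \<Rightarrow>\<^sub>0 complex) set" where
  "poly_ring X = {p. \<forall>m\<in>Poly_Mapping.keys p. set_mset m \<subseteq> X}"

definition ideal_generated ::
  "'a set \<Rightarrow> ('a multiset \<Rightarrow>\<^sub>0 complex) set \<Rightarrow> ('a multiset \<Rightarrow>\<^sub>0 complex) set" where
  "ideal_generated X G =
     {\<Sum>g\<in>F. q g * g | F q. finite F \<and> F \<subseteq> G \<and> (\<forall>g\<in>F. q g \<in> poly_ring X)}"

text \<open>
  The graded algebra of a polytope is realised inside the monoid algebra of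
  \<open>nat \<times> 'a\<close>: the basis element attached to a lattice point \<open>v\<close> of the \<open>m\<close>-fold
  Minkowski sum is \<open>Poly_Mapping.single (m, v) 1\<close>.
\<close>

definition polytope_algebra :: "'a::euclidean_space set \<Rightarrow> (nat \<times> 'a \<Rightarrow>\<^sub>0 complex) set" where
  "polytope_algebra P =
     {f. \<forall>(m, v)\<in>Poly_Mapping.keys f. v \<in> lattice_points (minkowski_multiple m P)}"

text \<open>
  The algebra homomorphism sending the variable of a lattice point \<open>v\<close> to \<open>v\<close> in degree 1.
\<close>

definition toric_map ::
  "('a::euclidean_space multiset \<Rightarrow>\<^sub>0 complex) \<Rightarrow> (nat \<times> 'a \<Rightarrow>\<^sub>0 complex)" where
  "toric_map p = (\<Sum>m\<in>Poly_Mapping.keys p.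
     Poly_Mapping.single 0 (Poly_Mapping.lookup p m) * (\<Prod>v\<in>#m. Poly_Mapping.single (1, v) 1))"

definition presenting_ideal ::
  "'a::euclidean_space set \<Rightarrow> ('a multiset \<Rightarrow>\<^sub>0 complex) set" where
  "presenting_ideal P = {p \<in> poly_ring (lattice_points P). toric_map p = 0}"

lemma single_zero_zero:
  "Poly_Mapping.single (0, 0) 1 = (1 :: nat \<times> 'a::euclidean_space \<Rightarrow>\<^sub>0 complex)"
  by (metis single_one zero_prod_def)

lemma prod_mset_single:
  "(\<Prod>v\<in>#m. Poly_Mapping.single (1, v) 1) =
     (Poly_Mapping.single (size m, \<Sum>\<^sub># m) 1 :: nat \<times> 'a::euclidean_space \<Rightarrow>\<^sub>0 complex)"
  by (induction m) (simp_all add: single_zero_zero mult_single)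

lemma toric_map_altdef:
  "toric_map p = (\<Sum>m\<in>Poly_Mapping.keys p.
     Poly_Mapping.single (size m, \<Sum>\<^sub># m) (Poly_Mapping.lookup p m))"
  unfolding toric_map_def prod_mset_single by (simp add: mult_single)

lemma sum_mset_in_minkowski_multiple:
  assumes "set_mset m \<subseteq> P"
  shows "\<Sum>\<^sub># m \<in> minkowski_multiple (size m) P"
proof -
  obtain xs where xs: "m = mset xs" by (metis ex_mset)
  have "\<Sum>\<^sub># m = (\<Sum>i<size m. xs ! i)"
    by (simp add: xs sum_mset_sum_list sum_list_sum_nth atLeast0LessThan)
  moreover have "\<forall>i<size m. xs ! i \<in> P"
    using assms by (auto simp: xs)
  ultimately show ?thesis
    unfolding minkowski_multiple_def by blast
qed

lemma sum_mset_in_lattice: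
  "set_mset m \<subseteq> int_lattice \<Longrightarrow> \<Sum>\<^sub># m \<in> int_lattice"
  by (induction m) (auto simp: int_lattice_def inner_add_left)

lemma toric_map_in_polytope_algebra:
  assumes "p \<in> poly_ring (lattice_points P)"
  shows "toric_map p \<in> polytope_algebra P"
proof -
  have "v \<in> lattice_points (minkowski_multiple k P)"
    if kv: "(k, v) \<in> Poly_Mapping.keys (toric_map p)" for k v
  proof -
    from kv have "(k, v) \<in> (\<Union>m\<in>Poly_Mapping.keys p. Poly_Mapping.keys
        (Poly_Mapping.single (size m, \<Sum>\<^sub># m) (Poly_Mapping.lookup p m)))"
      unfolding toric_map_altdef by (rule subsetD[OF keys_sum])
    then obtain m where m: "m \<in> Poly_Mapping.keys p" "k = size m" "v = \<Sum>\<^sub># m"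
      unfolding keys_single by (auto split: if_splits)
    with assms have "set_mset m \<subseteq> P" "set_mset m \<subseteq> int_lattice"
      by (auto simp: poly_ring_def lattice_points_def)
    then show ?thesis
      unfolding m lattice_points_def
      by (intro IntI sum_mset_in_minkowski_multiple sum_mset_in_lattice)
  qed
  then show ?thesis unfolding polytope_algebra_def by blast
qed

text \<open>
  An order on monomials is given by its strict part \<open>lt\<close>. It may have ties, in which case
  an initial form can have several terms. The initial form of \<open>0\<close> is \<open>0\<close>.
\<close>

definition initial_form ::
  "('a multiset \<Rightarrow> 'a multiset \<Rightarrow> bool) \<Rightarrow> ('a multiset \<Rightarrow>\<^sub>0 complex) \<Rightarrow> ('a multiset \<Rightarrow>\<^sub>0 complex)"
where
  "initial_form lt p =
     (\<Sum>m | m \<in> Poly_Mapping.keys p \<and> (\<forall>m'\<in>Poly_Mapping.keys p. \<not> lt m m').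
        Poly_Mapping.single m (Poly_Mapping.lookup p m))"

definition standard_monomial ::
  "'a::euclidean_space set \<Rightarrow> ('a multiset \<Rightarrow> 'a multiset \<Rightarrow> bool) \<Rightarrow> 'a multiset \<Rightarrow> bool" where
  "standard_monomial P lt m \<longleftrightarrow> set_mset m \<subseteq> lattice_points P \<and>
     \<not> (\<exists>p\<in>presenting_ideal P. initial_form lt p = Poly_Mapping.single m 1)"

definition total_degree :: "('a multiset \<Rightarrow>\<^sub>0 complex) \<Rightarrow> nat" where
  "total_degree p = Max (insert 0 (size ` Poly_Mapping.keys p))"

definition squarefree_monomial :: "'a multiset \<Rightarrow> bool" where
  "squarefree_monomial m \<longleftrightarrow> (\<forall>v. count m v \<le> 1)"

definition has_quadratic_squarefree_GB ::
  "'a::euclidean_space set \<Rightarrow> ('a multiset \<Rightarrow> 'a multiset \<Rightarrow> bool) \<Rightarrow> bool" where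
  "has_quadratic_squarefree_GB P lt \<longleftrightarrow>
     (\<exists>G \<subseteq> presenting_ideal P.
        (\<forall>g\<in>G. total_degree g = 2 \<and>
           (\<exists>c m. c \<noteq> 0 \<and> squarefree_monomial m \<and>
              initial_form lt g = Poly_Mapping.single m c)) \<and>
        ideal_generated (lattice_points P) (initial_form lt ` G) =
        ideal_generated (lattice_points P) (initial_form lt ` presenting_ideal P))"

text \<open>
  A term order \<open>\<Sigma>\<close> on \<open>P\<close> is a total function of which only the values at the lattice points
  of \<open>P\<close> matter.
\<close>

definition weight :: "('a \<Rightarrow> real) \<Rightarrow> 'a multiset \<Rightarrow> real" where
  "weight \<Sigma> m = (\<Sum>v\<in>#m. \<Sigma> v)"

definition weight_less :: "('a \<Rightarrow> real) \<Rightarrow> 'a multiset \<Rightarrow> 'a multiset \<Rightarrow> bool" where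
  "weight_less \<Sigma> m m' \<longleftrightarrow>
     size m < size m' \<or> (size m = size m' \<and> weight \<Sigma> m < weight \<Sigma> m')"

definition morphism ::
  "'a::euclidean_space set \<Rightarrow> ('a \<Rightarrow> real) \<Rightarrow> 'b::euclidean_space set \<Rightarrow> ('b \<Rightarrow> real) \<Rightarrow>
   ('a \<Rightarrow> 'b) \<Rightarrow> bool" where
  "morphism P \<Sigma> Q \<Gamma> \<pi> \<longleftrightarrow>
     linear \<pi> \<and> \<pi> ` int_lattice \<subseteq> int_lattice \<and> \<pi> ` P \<subseteq> Q \<and>
     (\<forall>m. standard_monomial P (weight_less \<Sigma>) m \<longrightarrow>
          standard_monomial Q (weight_less \<Gamma>) (image_mset \<pi> m))"

definition fiber_product ::
  "'a set \<Rightarrow> ('a \<Rightarrow> 'c) \<Rightarrow> 'b set \<Rightarrow> ('b \<Rightarrow> 'c) \<Rightarrow> ('a \<times> 'b) set" where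
  "fiber_product P\<^sub>1 \<pi>\<^sub>1 P\<^sub>2 \<pi>\<^sub>2 = {(V, W). V \<in> P\<^sub>1 \<and> W \<in> P\<^sub>2 \<and> \<pi>\<^sub>1 V = \<pi>\<^sub>2 W}"

definition box_point_less ::
  "('a \<Rightarrow> real) \<Rightarrow> ('b \<Rightarrow> real) \<Rightarrow> 'a \<times> 'b \<Rightarrow> 'a \<times> 'b \<Rightarrow> bool" where
  "box_point_less \<Sigma>\<^sub>1 \<Sigma>\<^sub>2 x y \<longleftrightarrow>
     \<Sigma>\<^sub>1 (fst x) < \<Sigma>\<^sub>1 (fst y) \<or>
     (\<Sigma>\<^sub>1 (fst x) = \<Sigma>\<^sub>1 (fst y) \<and> \<Sigma>\<^sub>2 (snd x) < \<Sigma>\<^sub>2 (snd y))"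

text \<open>
  If \<open>\<Sigma>\<^sub>1\<close> and \<open>\<Sigma>\<^sub>2\<close> are injective on the relevant points, then \<open>box_point_less\<close> is a
  strict linear order on pairs, so the following list exists and is unique.
\<close>

definition decreasing_factorization ::
  "('a \<Rightarrow> real) \<Rightarrow> ('b \<Rightarrow> real) \<Rightarrow> ('a \<times> 'b) multiset \<Rightarrow> ('a \<times> 'b) list \<Rightarrow> bool" where
  "decreasing_factorization \<Sigma>\<^sub>1 \<Sigma>\<^sub>2 m xs \<longleftrightarrow>
     mset xs = m \<and> sorted_wrt (\<lambda>x y. \<not> box_point_less \<Sigma>\<^sub>1 \<Sigma>\<^sub>2 x y) xs"

text \<open>\<open>lex\<close> compares lists of equal length at the first place where they differ.\<close>

definition box_less ::
  "('a \<Rightarrow> real) \<Rightarrow> ('b \<Rightarrow> real) \<Rightarrow> ('a \<times> 'b) multiset \<Rightarrow> ('a \<times> 'b) multiset \<Rightarrow> bool" where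
  "box_less \<Sigma>\<^sub>1 \<Sigma>\<^sub>2 m m' \<longleftrightarrow>
     (let w = weight (\<lambda>(V, W). \<Sigma>\<^sub>1 V + \<Sigma>\<^sub>2 W) in
      size m < size m' \<or>
      (size m = size m' \<and> w m < w m') \<or>
      (size m = size m' \<and> w m = w m' \<and>
        (\<exists>xs ys. decreasing_factorization \<Sigma>\<^sub>1 \<Sigma>\<^sub>2 m xs \<and>
                 decreasing_factorization \<Sigma>\<^sub>1 \<Sigma>\<^sub>2 m' ys \<and>
                 (xs, ys) \<in> lex {(x, y). box_point_less \<Sigma>\<^sub>1 \<Sigma>\<^sub>2 x y})))"

end

theory Submission imports Defs begin

text \<open>
  The presenting ideal is spanned by differences of monomials of equal degree and equal sum of
  factors, so everything can be read off from the fibers of the map sending a monomial to its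
  degree and sum. For a weight order whose initial ideal is generated by quadratic square-free
  monomials, every fiber has exactly one monomial of least weight, the standard one, and any other
  monomial of the fiber has a square-free quadratic factor that is not of least weight in its own
  fiber (\<open>nonminimal_contains_quadratic\<close>). Conversely, for an order that is total on monomials,
  a quadratic square-free Groebner basis exists as soon as every monomial that is not least in its
  fiber has a square-free quadratic factor that is not least
  (\<open>has_quadratic_squarefree_GB_if_total\<close>). So the task is to find such a factor in a
  monomial \<open>m\<close> of the fiber product that is not least.

  Assume that \<open>m\<close> has no such factor. A quadratic factor \<open>r\<close> of \<open>m\<close> has two projections, to
  \<open>P\<^sub>1\<close> and to \<open>P\<^sub>2\<close>. Replace both by the standard monomials of their fibers. A morphism keeps
  monomials standard, so the images in \<open>Q\<close> are standard; they have the same degree and sum, and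
  a fiber over \<open>Q\<close> has only one standard monomial, so the images agree and the two standard
  monomials can be paired to a monomial of the fiber product (\<open>fiber_minima_lift\<close>). Its weight
  is at most that of \<open>r\<close>, with a drop if one of the projections was not standard. Hence all
  square-free quadratic factors of \<open>m\<close> have minimal projections, and by the
  quadratic square-free bases of \<open>P\<^sub>1\<close> and \<open>P\<^sub>2\<close> so does \<open>m\<close>.

  A monomial below \<open>m\<close> in its fiber must then have the same two projections and differ only in
  the way in which they are paired, and it is the tie-breaking rule that compares the pairings. Swapping the
  partners of two factors \<open>(V, W)\<close> and \<open>(V', W')\<close> over the same point of \<open>Q\<close>, where \<open>V\<close> is below
  \<open>V'\<close> and \<open>W\<close> below \<open>W'\<close>, lowers the monomial. As no quadratic factor can be lowered, larger
  \<open>V\<close> are paired with smaller \<open>W\<close> over every point of \<open>Q\<close>, and a counting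
  argument shows that nothing lies below such a pairing (\<open>antisorted_pairing_lex_minimal\<close>).
\<close>


section \<open>Monomials, fibers and initial forms\<close>

text \<open>
  The monomials with the same image in the polytope algebra as \<open>m\<close>.
\<close>

definition toric_fiber :: "'a::euclidean_space set \<Rightarrow> 'a multiset \<Rightarrow> 'a multiset set" where
  "toric_fiber X m = {m'. set_mset m' \<subseteq> X \<and> size m' = size m \<and> \<Sum>\<^sub># m' = \<Sum>\<^sub># m}"

lemma toric_fiber_exchange:
  assumes "set_mset m \<subseteq> X" "q \<subseteq># m" "q' \<in> toric_fiber X q"
  shows "m - q + q' \<in> toric_fiber X m"
proof -
  obtain r where r: "m = q + r" using assms(2) by (metis subset_mset.add_diff_inverse)
  show ?thesis using assms unfolding r toric_fiber_def by auto
qed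

lemma lookup_initial_form:
  "Poly_Mapping.lookup (initial_form lt p) m =
     (if m \<in> Poly_Mapping.keys p \<and> (\<forall>m'\<in>Poly_Mapping.keys p. \<not> lt m m')
      then Poly_Mapping.lookup p m else 0)"
  unfolding initial_form_def lookup_sum by (simp add: lookup_single when_def)

lemma keys_initial_form:
  "Poly_Mapping.keys (initial_form lt p) =
     {m \<in> Poly_Mapping.keys p. \<forall>m'\<in>Poly_Mapping.keys p. \<not> lt m m'}"
  by (auto simp: in_keys_iff[of _ "initial_form lt p"] lookup_initial_form split: if_splits)

lemma lookup_toric_map:
  "Poly_Mapping.lookup (toric_map p) (size m, \<Sum>\<^sub># m) =
     (\<Sum>m' | m' \<in> Poly_Mapping.keys p \<and> size m' = size m \<and> \<Sum>\<^sub># m' = \<Sum>\<^sub># m.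
        Poly_Mapping.lookup p m')"
  unfolding toric_map_altdef lookup_sum
  by (simp add: lookup_single when_def sum.If_cases Int_def)

text \<open>
  The coefficients over one fiber sum to zero, because all its monomials have the same image.
\<close>

lemma presenting_ideal_second_term:
  assumes "p \<in> presenting_ideal P" "m \<in> Poly_Mapping.keys p"
  shows "\<exists>m'\<in>Poly_Mapping.keys p. m' \<noteq> m \<and> m' \<in> toric_fiber (lattice_points P) m"
proof (rule ccontr)
  assume *: "\<not> ?thesis"
  have sup: "set_mset m' \<subseteq> lattice_points P" if "m' \<in> Poly_Mapping.keys p" for m'
    using assms(1) that by (auto simp: presenting_ideal_def poly_ring_def)
  have "{m' \<in> Poly_Mapping.keys p. size m' = size m \<and> \<Sum>\<^sub># m' = \<Sum>\<^sub># m} = {m}"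
    using * assms(2) sup by (auto simp: toric_fiber_def)
  then have "Poly_Mapping.lookup (toric_map p) (size m, \<Sum>\<^sub># m) = Poly_Mapping.lookup p m"
    by (simp add: lookup_toric_map)
  with assms show False by (auto simp: presenting_ideal_def in_keys_iff)
qed

lemma lookup_binomial:
  assumes "m \<noteq> m'"
  shows "Poly_Mapping.lookup (Poly_Mapping.single m 1 - Poly_Mapping.single m' 1 :: 'b \<Rightarrow>\<^sub>0 complex) x =
    (if x = m then 1 else if x = m' then -1 else 0)"
  using assms by (auto simp: lookup_minus lookup_single when_def)

lemma keys_binomial:
  assumes "m \<noteq> m'"
  shows "Poly_Mapping.keys (Poly_Mapping.single m 1 - Poly_Mapping.single m' 1 :: 'b \<Rightarrow>\<^sub>0 complex) = {m, m'}"
  using assms by (auto simp: in_keys_iff lookup_binomial split: if_splits)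

lemma binomial_in_presenting_ideal:
  assumes "set_mset m \<subseteq> lattice_points P" "m' \<in> toric_fiber (lattice_points P) m" "m' \<noteq> m"
  shows "Poly_Mapping.single m 1 - Poly_Mapping.single m' 1 \<in> presenting_ideal P"
    (is "?p \<in> _")
proof -
  have k: "Poly_Mapping.keys ?p = {m, m'}" using assms(3) by (simp add: keys_binomial)
  have "?p \<in> poly_ring (lattice_points P)"
    using assms by (auto simp: poly_ring_def k toric_fiber_def)
  moreover have "toric_map ?p = 0"
    using assms not_sym[OF assms(3)]
    by (simp add: toric_map_altdef k lookup_binomial toric_fiber_def flip: single_add)
  ultimately show ?thesis by (simp add: presenting_ideal_def)
qed

lemma initial_form_binomial:
  assumes "lt m' m" "\<not> lt m m'" "\<not> lt m m"
  shows "initial_form lt (Poly_Mapping.single m 1 - Poly_Mapping.single m' 1) =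
    Poly_Mapping.single m 1"
proof -
  have ne: "m \<noteq> m'" using assms by auto
  show ?thesis
    by (rule poly_mapping_eqI)
      (use assms ne in \<open>auto simp: lookup_initial_form lookup_binomial keys_binomial lookup_single when_def\<close>)
qed

section \<open>Generated ideals\<close>

lemma monomial_of_generated_ideal:
  assumes "p \<in> ideal_generated X G" "m \<in> Poly_Mapping.keys p"
  shows "\<exists>g\<in>G. \<exists>q\<in>Poly_Mapping.keys g. q \<subseteq># m"
proof -
  obtain F h where F: "finite F" "F \<subseteq> G" and p: "p = (\<Sum>g\<in>F. h g * g)"
    using assms(1) by (auto simp: ideal_generated_def)
  obtain g where g: "g \<in> F" "m \<in> Poly_Mapping.keys (h g * g)"
    using assms(2) keys_sum[of "\<lambda>g. h g * g" F] unfolding p by auto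
  then obtain a b where "m = a + b" "b \<in> Poly_Mapping.keys g"
    using keys_mult[of "h g" g] by auto
  with g F show ?thesis by (metis mset_subset_eq_add_right subsetD)
qed

lemma multiple_in_generated_ideal:
  assumes "g \<in> G" "a \<in> poly_ring X"
  shows "a * g \<in> ideal_generated X G"
  unfolding ideal_generated_def
  by (rule CollectI, rule exI[of _ "{g}"], rule exI[of _ "\<lambda>_. a"]) (use assms in auto)

lemma one_in_poly_ring: "1 \<in> poly_ring X"
  by (simp add: poly_ring_def)

lemma generator_in_generated_ideal: "g \<in> G \<Longrightarrow> g \<in> ideal_generated X G"
  using multiple_in_generated_ideal[OF _ one_in_poly_ring] by fastforce

lemma zero_in_generated_ideal: "0 \<in> ideal_generated X G"
  unfolding ideal_generated_def
  by (rule CollectI, rule exI[of _ "{}"]) auto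

lemma ideal_generated_mono: "G \<subseteq> H \<Longrightarrow> ideal_generated X G \<subseteq> ideal_generated X H"
  unfolding ideal_generated_def by blast

lemma poly_ring_add: "a \<in> poly_ring X \<Longrightarrow> b \<in> poly_ring X \<Longrightarrow> a + b \<in> poly_ring X"
  using keys_add[of a b] by (fastforce simp: poly_ring_def)

lemma poly_ring_mult:
  assumes "a \<in> poly_ring X" "b \<in> poly_ring X" shows "a * b \<in> poly_ring X"
  unfolding poly_ring_def
proof (intro CollectI ballI)
  fix m assume "m \<in> Poly_Mapping.keys (a * b)"
  then obtain u v where "m = u + v" "u \<in> Poly_Mapping.keys a" "v \<in> Poly_Mapping.keys b"
    using keys_mult[of a b] by auto
  with assms show "set_mset m \<subseteq> X" by (auto simp: poly_ring_def)
qed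

lemma generated_ideal_add:
  assumes "a \<in> ideal_generated X G" "b \<in> ideal_generated X G"
  shows "a + b \<in> ideal_generated X G"
proof -
  obtain A h where A: "finite A" "A \<subseteq> G" "\<forall>g\<in>A. h g \<in> poly_ring X" "a = (\<Sum>g\<in>A. h g * g)"
    using assms(1) by (auto simp: ideal_generated_def)
  obtain B k where B: "finite B" "B \<subseteq> G" "\<forall>g\<in>B. k g \<in> poly_ring X" "b = (\<Sum>g\<in>B. k g * g)"
    using assms(2) by (auto simp: ideal_generated_def)
  \<comment> \<open>A polynomial can be a generator in both representations, so the cofactors are added on the union.\<close>
  define c where "c g = (if g \<in> A then h g else 0) + (if g \<in> B then k g else 0)" for g
  have "a = (\<Sum>g\<in>A \<union> B. (if g \<in> A then h g else 0) * g)"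
    unfolding A(4) by (rule sum.mono_neutral_cong_left) (use A B in auto)
  moreover have "b = (\<Sum>g\<in>A \<union> B. (if g \<in> B then k g else 0) * g)"
    unfolding B(4) by (rule sum.mono_neutral_cong_left) (use A B in auto)
  ultimately have "a + b = (\<Sum>g\<in>A \<union> B. c g * g)"
    by (simp add: c_def distrib_right sum.distrib)
  moreover have "(0 :: 'a multiset \<Rightarrow>\<^sub>0 complex) \<in> poly_ring X" by (simp add: poly_ring_def)
  then have "c g \<in> poly_ring X" if "g \<in> A \<union> B" for g
    using that A B by (auto simp: c_def intro!: poly_ring_add)
  ultimately show ?thesis
    unfolding ideal_generated_def
    using A B by (intro CollectI exI[of _ "A \<union> B"] exI[of _ c]) auto
qed

lemma generated_ideal_mult:
  assumes "a \<in> poly_ring X" "b \<in> ideal_generated X G"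
  shows "a * b \<in> ideal_generated X G"
proof -
  obtain B k where B: "finite B" "B \<subseteq> G" "\<forall>g\<in>B. k g \<in> poly_ring X" "b = (\<Sum>g\<in>B. k g * g)"
    using assms(2) by (auto simp: ideal_generated_def)
  have "a * b = (\<Sum>g\<in>B. (a * k g) * g)" by (simp add: B(4) sum_distrib_left mult.assoc)
  with B show ?thesis
    unfolding ideal_generated_def using assms(1)
    by (intro CollectI exI[of _ B] exI[of _ "\<lambda>g. a * k g"]) (auto intro: poly_ring_mult)
qed

lemma generated_ideal_least:
  assumes "G \<subseteq> ideal_generated X H"
  shows "ideal_generated X G \<subseteq> ideal_generated X H"
proof
  fix p assume "p \<in> ideal_generated X G"
  then obtain F k where F: "finite F" "F \<subseteq> G" "\<forall>g\<in>F. k g \<in> poly_ring X"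
    and p: "p = (\<Sum>g\<in>F. k g * g)"
    by (auto simp: ideal_generated_def)
  show "p \<in> ideal_generated X H" unfolding p using F
  proof (induction F rule: finite_induct)
    case empty
    then show ?case by (simp add: zero_in_generated_ideal)
  next
    case (insert g F)
    then show ?case using assms by (auto intro!: generated_ideal_add generated_ideal_mult)
  qed
qed

section \<open>Quadratic square-free initial ideals in terms of fibers\<close>

text \<open>
  By totality an initial form has at most one monomial \<open>m\<close>. By
  \<open>presenting_ideal_second_term\<close> there is another monomial in the fiber of \<open>m\<close>, and it lies
  below \<open>m\<close>. So the binomials \<open>q - q'\<close> with \<open>q\<close> quadratic, square-free and above \<open>q'\<close> form the
  required basis: one of these \<open>q\<close> divides \<open>m\<close>.
\<close>

lemma has_quadratic_squarefree_GB_if_total: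
  fixes P :: "'a::euclidean_space set"
  defines "S \<equiv> lattice_points P"
  assumes total: "\<And>m m'. set_mset m \<subseteq> S \<Longrightarrow> set_mset m' \<subseteq> S \<Longrightarrow> m \<noteq> m' \<Longrightarrow> lt m m' \<or> lt m' m"
    and asym: "\<And>m m'. set_mset m \<subseteq> S \<Longrightarrow> set_mset m' \<subseteq> S \<Longrightarrow> lt m m' \<Longrightarrow> \<not> lt m' m"
    and quadratic: "\<And>m m'. set_mset m \<subseteq> S \<Longrightarrow> m' \<in> toric_fiber S m \<Longrightarrow> lt m' m \<Longrightarrow>
      \<exists>q. q \<subseteq># m \<and> size q = 2 \<and> squarefree_monomial q \<and> (\<exists>q'\<in>toric_fiber S q. lt q' q)"
  shows "has_quadratic_squarefree_GB P lt"
proof -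
  let ?I = "presenting_ideal P"
  let ?b = "\<lambda>q q'. Poly_Mapping.single q 1 - Poly_Mapping.single q' (1::complex)"
  define G where "G = {?b q q' | q q'. set_mset q \<subseteq> S \<and> size q = 2 \<and> squarefree_monomial q \<and>
    q' \<in> toric_fiber S q \<and> lt q' q}"
  have supp: "set_mset m \<subseteq> S" if "p \<in> ?I" "m \<in> Poly_Mapping.keys p" for p m
    using that by (auto simp: presenting_ideal_def poly_ring_def S_def)
  have binom: "?b q q' \<in> ?I" "initial_form lt (?b q q') = Poly_Mapping.single q 1"
    "total_degree (?b q q') = size q"
    if "set_mset q \<subseteq> S" "q' \<in> toric_fiber S q" "lt q' q" for q q'
  proof -
    have "set_mset q' \<subseteq> S" "size q' = size q" using that by (auto simp: toric_fiber_def)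
    moreover from this have "q' \<noteq> q" "\<not> lt q q'" "\<not> lt q q" using asym that by blast+
    ultimately show "?b q q' \<in> ?I" "initial_form lt (?b q q') = Poly_Mapping.single q 1"
      "total_degree (?b q q') = size q"
      using that binomial_in_presenting_ideal[of q P q']
      by (auto simp: S_def initial_form_binomial total_degree_def keys_binomial)
  qed
  have "G \<subseteq> ?I" unfolding G_def using binom by blast
  moreover have "total_degree g = 2 \<and>
      (\<exists>c m. c \<noteq> 0 \<and> squarefree_monomial m \<and> initial_form lt g = Poly_Mapping.single m c)"
    if "g \<in> G" for g
  proof -
    obtain q q' where q: "g = ?b q q'" "set_mset q \<subseteq> S" "size q = 2" "squarefree_monomial q"
      "q' \<in> toric_fiber S q" "lt q' q" using \<open>g \<in> G\<close> unfolding G_def by blast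
    show ?thesis using binom[OF q(2,5,6)] q(3,4) unfolding q(1)
      by (metis zero_neq_one)
  qed
  moreover have "initial_form lt p \<in> ideal_generated S (initial_form lt ` G)" if p: "p \<in> ?I" for p
  proof (cases "initial_form lt p = 0")
    case False
    then obtain m where m: "m \<in> Poly_Mapping.keys (initial_form lt p)" by fastforce
    let ?c = "Poly_Mapping.lookup p m"
    have mp: "m \<in> Poly_Mapping.keys p" and max: "\<And>x. x \<in> Poly_Mapping.keys p \<Longrightarrow> \<not> lt m x"
      using m by (auto simp: keys_initial_form)
    have below: "lt x m" if "x \<in> Poly_Mapping.keys p" "x \<noteq> m" for x
      using total[of x m] that max supp p mp by blast
    have init: "initial_form lt p = Poly_Mapping.single m ?c"
      by (rule poly_mapping_eqI)
        (use mp below max in \<open>auto simp: lookup_initial_form lookup_single when_def\<close>)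
    obtain m' where m': "m' \<in> Poly_Mapping.keys p" "m' \<noteq> m" "m' \<in> toric_fiber S m"
      using presenting_ideal_second_term[OF p mp] by (auto simp: S_def)
    obtain q q' where q: "q \<subseteq># m" "size q = 2" "squarefree_monomial q"
      "q' \<in> toric_fiber S q" "lt q' q"
      using quadratic[OF supp[OF p mp] m'(3) below[OF m'(1,2)]] by auto
    have qS: "set_mset q \<subseteq> S" using q(1) supp[OF p mp] by (meson order_trans set_mset_mono)
    have "?b q q' \<in> G" using q qS by (auto simp: G_def)
    then have "Poly_Mapping.single q 1 \<in> initial_form lt ` G"
      using binom(2)[OF qS q(4,5)] by (metis imageI)
    moreover have "Poly_Mapping.single (m - q) ?c \<in> poly_ring S"
      using supp[OF p mp] by (auto simp: poly_ring_def dest: in_diffD)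
    ultimately have "Poly_Mapping.single (m - q) ?c * Poly_Mapping.single q 1
        \<in> ideal_generated S (initial_form lt ` G)"
      by (rule multiple_in_generated_ideal)
    then show ?thesis using q(1) by (simp add: init mult_single)
  qed (simp add: zero_in_generated_ideal)
  then have "ideal_generated S (initial_form lt ` ?I) \<subseteq> ideal_generated S (initial_form lt ` G)"
    by (intro generated_ideal_least) auto
  moreover have "ideal_generated S (initial_form lt ` G) \<subseteq> ideal_generated S (initial_form lt ` ?I)"
    using \<open>G \<subseteq> ?I\<close> by (intro ideal_generated_mono image_mono)
  ultimately show ?thesis
    unfolding has_quadratic_squarefree_GB_def S_def[symmetric] by blast
qed

lemma weight_union: "weight \<Sigma> (m + m') = weight \<Sigma> m + weight \<Sigma> m'"
  by (simp add: weight_def)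

text \<open>
  Since \<open>q\<close> is the only term of the initial form, the second term of \<open>p\<close> in the fiber of \<open>q\<close> has
  strictly smaller weight; equal weight would put it into the initial form.
\<close>

lemma initial_monomial_not_minimal:
  assumes p: "p \<in> presenting_ideal P" and init: "initial_form (weight_less \<Sigma>) p = Poly_Mapping.single q c"
    and c: "c \<noteq> 0"
  shows "\<exists>q'\<in>toric_fiber (lattice_points P) q. weight \<Sigma> q' < weight \<Sigma> q"
proof -
  have k: "{m \<in> Poly_Mapping.keys p. \<forall>m'\<in>Poly_Mapping.keys p. \<not> weight_less \<Sigma> m m'} = {q}"
    using keys_initial_form[of "weight_less \<Sigma>" p] c unfolding init by simp
  then have q: "q \<in> Poly_Mapping.keys p" "\<And>x. x \<in> Poly_Mapping.keys p \<Longrightarrow> \<not> weight_less \<Sigma> q x"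
    by auto
  obtain q' where q': "q' \<in> Poly_Mapping.keys p" "q' \<noteq> q" "q' \<in> toric_fiber (lattice_points P) q"
    using presenting_ideal_second_term[OF p q(1)] by auto
  have "\<exists>x\<in>Poly_Mapping.keys p. weight_less \<Sigma> q' x" using k q'(1,2) by blast
  then have "weight \<Sigma> q' < weight \<Sigma> q"
    using q(2) q'(1,3) by (force simp: weight_less_def toric_fiber_def)
  with q' show ?thesis by blast
qed

text \<open>
  The initial form of \<open>m - m'\<close> contains \<open>m\<close>, as the single term or, for equal weights, as one of
  two. In both cases it lies in the ideal generated by the initial monomials of the basis, and this is
  a monomial ideal, so one of them divides \<open>m\<close>. That ties are covered is what makes
  the standard monomial of a fiber unique.
\<close>

lemma nonminimal_contains_quadratic:
  assumes GB: "has_quadratic_squarefree_GB P (weight_less \<Sigma>)"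
    and m: "set_mset m \<subseteq> lattice_points P"
    and m': "m' \<in> toric_fiber (lattice_points P) m" "m' \<noteq> m" "weight \<Sigma> m' \<le> weight \<Sigma> m"
  shows "\<exists>q. q \<subseteq># m \<and> size q = 2 \<and> squarefree_monomial q \<and>
    (\<exists>q'\<in>toric_fiber (lattice_points P) q. weight \<Sigma> q' < weight \<Sigma> q)"
proof -
  let ?in = "initial_form (weight_less \<Sigma>)"
  let ?p = "Poly_Mapping.single m 1 - Poly_Mapping.single m' (1::complex)"
  obtain G where G: "G \<subseteq> presenting_ideal P"
    "\<And>g. g \<in> G \<Longrightarrow> total_degree g = 2 \<and>
       (\<exists>c m. c \<noteq> 0 \<and> squarefree_monomial m \<and> ?in g = Poly_Mapping.single m c)"
    "ideal_generated (lattice_points P) (?in ` G) =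
      ideal_generated (lattice_points P) (?in ` presenting_ideal P)"
    using GB unfolding has_quadratic_squarefree_GB_def by metis
  have "?in ?p \<in> ideal_generated (lattice_points P) (?in ` G)"
    unfolding G(3) using binomial_in_presenting_ideal[OF m m'(1,2)]
    by (intro generator_in_generated_ideal imageI)
  moreover have "m \<in> Poly_Mapping.keys (?in ?p)"
    using m' by (auto simp: keys_initial_form keys_binomial weight_less_def toric_fiber_def)
  ultimately obtain g q where g: "g \<in> G" "q \<in> Poly_Mapping.keys (?in g)" "q \<subseteq># m"
    using monomial_of_generated_ideal by blast
  obtain c x where "c \<noteq> 0" "squarefree_monomial x" "?in g = Poly_Mapping.single x c"
    using G(2)[OF g(1)] by blast
  with g(2) have q: "c \<noteq> 0" "squarefree_monomial q" "?in g = Poly_Mapping.single q c"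
    by (auto split: if_splits)
  have qg: "q \<in> Poly_Mapping.keys g" "\<And>x. x \<in> Poly_Mapping.keys g \<Longrightarrow> size x \<le> size q"
    using g(2) by (force simp: keys_initial_form weight_less_def)+
  then have "Max (insert 0 (size ` Poly_Mapping.keys g)) = size q"
    by (intro Max_eqI) auto
  then have "size q = 2" using G(2)[OF g(1)] by (simp add: total_degree_def)
  moreover have "\<exists>q'\<in>toric_fiber (lattice_points P) q. weight \<Sigma> q' < weight \<Sigma> q"
    using initial_monomial_not_minimal[OF _ q(3,1)] g(1) G(1) by blast
  ultimately show ?thesis using g(3) q(2) by blast
qed

text \<open>
  Minimality is strict: the difference of two monomials of equal least weight is its own
  initial form, so neither of them is standard when the initial ideal is a monomial ideal.
\<close>

definition fiber_minimum :: "'a::euclidean_space set \<Rightarrow> ('a \<Rightarrow> real) \<Rightarrow> 'a multiset \<Rightarrow> bool" where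
  "fiber_minimum P \<Sigma> m \<longleftrightarrow> set_mset m \<subseteq> lattice_points P \<and>
     (\<forall>m'\<in>toric_fiber (lattice_points P) m. m' \<noteq> m \<longrightarrow> weight \<Sigma> m < weight \<Sigma> m')"

lemma fiber_minimum_le:
  "fiber_minimum P \<Sigma> m \<Longrightarrow> m' \<in> toric_fiber (lattice_points P) m \<Longrightarrow> weight \<Sigma> m \<le> weight \<Sigma> m'"
  unfolding fiber_minimum_def by fastforce

lemma fiber_minimum_imp_standard:
  assumes "fiber_minimum P \<Sigma> m"
  shows "standard_monomial P (weight_less \<Sigma>) m"
  using initial_monomial_not_minimal[of _ P \<Sigma> m 1] fiber_minimum_le[OF assms] assms
  unfolding standard_monomial_def fiber_minimum_def by fastforce

text \<open>
  A monomial that is not the strict minimum need not have a lighter monomial in its fiber for an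
  arbitrary weight, only one of equal weight. With a quadratic square-free basis, exchanging a
  quadratic factor produces a lighter monomial, and the difference has \<open>m\<close> as its initial form.
\<close>

lemma standard_imp_fiber_minimum:
  assumes GB: "has_quadratic_squarefree_GB P (weight_less \<Sigma>)"
    and std: "standard_monomial P (weight_less \<Sigma>) m"
  shows "fiber_minimum P \<Sigma> m"
proof (rule ccontr)
  let ?S = "lattice_points P"
  have m: "set_mset m \<subseteq> ?S" using std by (simp add: standard_monomial_def)
  assume "\<not> ?thesis"
  then obtain m' where "m' \<in> toric_fiber ?S m" "m' \<noteq> m" "weight \<Sigma> m' \<le> weight \<Sigma> m"
    using m by (fastforce simp: fiber_minimum_def)
  then obtain q q' where q: "q \<subseteq># m" "q' \<in> toric_fiber ?S q" "weight \<Sigma> q' < weight \<Sigma> q"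
    using nonminimal_contains_quadratic[OF GB m] by blast
  let ?m = "m - q + q'"
  have fib: "?m \<in> toric_fiber ?S m" by (rule toric_fiber_exchange[OF m q(1,2)])
  have "weight \<Sigma> m = weight \<Sigma> (m - q) + weight \<Sigma> q"
    using q(1) by (simp flip: weight_union)
  then have lt: "weight \<Sigma> ?m < weight \<Sigma> m" using q(3) by (simp add: weight_union)
  then have "?m \<noteq> m" by auto
  then have "Poly_Mapping.single m 1 - Poly_Mapping.single ?m 1 \<in> presenting_ideal P"
    by (intro binomial_in_presenting_ideal m fib)
  moreover have "initial_form (weight_less \<Sigma>) (Poly_Mapping.single m 1 - Poly_Mapping.single ?m 1)
      = Poly_Mapping.single m 1"
    using lt fib by (intro initial_form_binomial) (auto simp: weight_less_def toric_fiber_def)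
  ultimately show False using std unfolding standard_monomial_def by blast
qed

lemma fiber_minimum_unique:
  assumes "fiber_minimum P \<Sigma> m" "fiber_minimum P \<Sigma> m'" "size m = size m'" "\<Sum>\<^sub># m = \<Sum>\<^sub># m'"
  shows "m = m'"
proof (rule ccontr)
  assume "m \<noteq> m'"
  with assms have "weight \<Sigma> m < weight \<Sigma> m'" "weight \<Sigma> m' < weight \<Sigma> m"
    by (auto simp: fiber_minimum_def toric_fiber_def)
  then show False by simp
qed

lemma finite_lattice_points:
  fixes P :: "'a::euclidean_space set"
  assumes "lattice_polytope P"
  shows "finite (lattice_points P)"
proof -
  obtain V where "finite V" "P = convex hull V" using assms by (auto simp: lattice_polytope_def)
  then have "bounded P" by (simp add: finite_imp_compact_convex_hull compact_imp_bounded)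
  then obtain B where B: "\<And>x. x \<in> P \<Longrightarrow> norm x \<le> B" by (auto simp: bounded_iff)
  let ?f = "\<lambda>x::'a. \<lambda>b\<in>Basis. x \<bullet> b"
  let ?A = "{k::real. k \<in> \<int> \<and> \<bar>k\<bar> \<le> B}"
  have "?f ` lattice_points P \<subseteq> Basis \<rightarrow>\<^sub>E ?A"
    using B by (fastforce simp: lattice_points_def int_lattice_def intro: order_trans[OF Basis_le_norm])
  moreover have "finite (Basis \<rightarrow>\<^sub>E ?A)" by (intro finite_PiE finite_abs_int_segment) auto
  ultimately have "finite (?f ` lattice_points P)" by (rule finite_subset)
  moreover have "inj_on ?f (lattice_points P)"
    by (rule inj_onI, rule euclidean_eqI) (metis restrict_apply')
  ultimately show ?thesis by (rule finite_imageD)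
qed

text \<open>
  Fibers are finite, since a polytope has finitely many lattice points, so some monomial has least
  weight. It has no competitor of equal weight, because such a competitor would
  allow an exchange that lowers the weight.
\<close>

lemma fiber_minimum_exists:
  assumes P: "lattice_polytope P" and GB: "has_quadratic_squarefree_GB P (weight_less \<Sigma>)"
    and m: "set_mset m \<subseteq> lattice_points P"
  shows "\<exists>m'\<in>toric_fiber (lattice_points P) m. fiber_minimum P \<Sigma> m'"
proof -
  let ?S = "lattice_points P"
  have "finite {m'. set_mset m' \<subseteq> ?S \<and> size m' = size m}"
    using finite_multisets_of_size[OF finite_lattice_points[OF P]] by (simp add: multisets_of_size_def)
  then have "finite (toric_fiber ?S m)"
    by (rule rev_finite_subset) (auto simp: toric_fiber_def)
  moreover have "m \<in> toric_fiber ?S m" using m by (simp add: toric_fiber_def)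
  ultimately obtain a where a: "a \<in> toric_fiber ?S m"
    "\<And>x. x \<in> toric_fiber ?S m \<Longrightarrow> weight \<Sigma> a \<le> weight \<Sigma> x"
    using ex_is_arg_min_if_finite[of "toric_fiber ?S m" "weight \<Sigma>"]
    by (auto simp: is_arg_min_linorder)
  have aS: "set_mset a \<subseteq> ?S" and same: "toric_fiber ?S a = toric_fiber ?S m"
    using a(1) by (auto simp: toric_fiber_def)
  have "fiber_minimum P \<Sigma> a"
  proof (rule ccontr)
    assume "\<not> ?thesis"
    then obtain x where "x \<in> toric_fiber ?S a" "x \<noteq> a" "weight \<Sigma> x \<le> weight \<Sigma> a"
      using aS by (fastforce simp: fiber_minimum_def)
    then obtain q q' where q: "q \<subseteq># a" "q' \<in> toric_fiber ?S q" "weight \<Sigma> q' < weight \<Sigma> q"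
      using nonminimal_contains_quadratic[OF GB aS] by blast
    have "weight \<Sigma> a \<le> weight \<Sigma> (a - q + q')"
      using a(2) toric_fiber_exchange[OF aS q(1,2)] same by blast
    moreover have "weight \<Sigma> a = weight \<Sigma> (a - q) + weight \<Sigma> q"
      using q(1) by (simp flip: weight_union)
    ultimately show False using q(3) by (simp add: weight_union)
  qed
  with a(1) show ?thesis by blast
qed

section \<open>Fiber products\<close>

lemma sum_mset_prod: "\<Sum>\<^sub># r = (\<Sum>\<^sub># (image_mset fst r), \<Sum>\<^sub># (image_mset snd r))"
  by (induction r) (simp_all add: zero_prod_def prod_eq_iff)

lemma lattice_points_fiber_product:
  "lattice_points (fiber_product P\<^sub>1 \<pi>\<^sub>1 P\<^sub>2 \<pi>\<^sub>2) =
    {z. fst z \<in> lattice_points P\<^sub>1 \<and> snd z \<in> lattice_points P\<^sub>2 \<and> \<pi>\<^sub>1 (fst z) = \<pi>\<^sub>2 (snd z)}"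
  by (auto simp: lattice_points_def fiber_product_def int_lattice_def Basis_prod_def ball_Un)

lemma linear_sum_mset: "linear f \<Longrightarrow> \<Sum>\<^sub># (image_mset f m) = f (\<Sum>\<^sub># m)"
  by (induction m) (simp_all add: linear_0 linear_add)

text \<open>
  Two multisets with the same image can be paired off so that partners have equal images. This
  is how monomials on \<open>P\<^sub>1\<close> and \<open>P\<^sub>2\<close> over the same monomial on \<open>Q\<close> become a monomial on the
  fiber product.
\<close>

lemma mset_fiber_product:
  assumes "image_mset f A = image_mset g B"
  shows "\<exists>R. image_mset fst R = A \<and> image_mset snd R = B \<and> (\<forall>z\<in>#R. f (fst z) = g (snd z))"
  using assms
proof (induction A arbitrary: B)
  case (add a A)
  then obtain b B' where b: "B = add_mset b B'" "g b = f a" "image_mset g B' = image_mset f A"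
    by (metis image_mset_add_mset msed_map_invR)
  then obtain R where "image_mset fst R = A" "image_mset snd R = B'" "\<forall>z\<in>#R. f (fst z) = g (snd z)"
    using add.IH[of B'] by auto
  with b show ?case by (intro exI[of _ "add_mset (a, b) R"]) auto
qed simp

lemma subset_image_mset_obtain:
  assumes "q \<subseteq># image_mset f m"
  obtains r where "r \<subseteq># m" "image_mset f r = q"
  using assms by (metis image_mset_eq_plusD mset_subset_eq_add_left subset_mset.add_diff_inverse)

lemma squarefree_monomial_image_mset:
  "squarefree_monomial (image_mset f r) \<Longrightarrow> squarefree_monomial r"
proof (unfold squarefree_monomial_def, rule allI)
  fix v assume "\<forall>v. count (image_mset f r) v \<le> 1"
  then have "count (image_mset f r) (f v) \<le> 1" by blast
  moreover have "count r v \<le> count (image_mset f r) (f v)"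
    unfolding count_image_mset' by (cases "v \<in># r") (auto intro!: member_le_sum simp: not_in_iff)
  ultimately show "count r v \<le> 1" by simp
qed

text \<open>
  A monomial \<open>m\<close> of the fiber product is compared with its image under a projection \<open>f\<close>: a
  quadratic square-free factor of the image comes from a factor of \<open>m\<close>, which is again
  square-free, so it suffices to control the square-free quadratic factors of \<open>m\<close> itself.
\<close>

lemma fiber_minimum_image_if_quadratic:
  assumes GB: "has_quadratic_squarefree_GB P (weight_less \<Sigma>)"
    and fm: "f ` set_mset m \<subseteq> lattice_points P"
    and quadratic: "\<And>r a. r \<subseteq># m \<Longrightarrow> size r = 2 \<Longrightarrow> squarefree_monomial r \<Longrightarrow>
      a \<in> toric_fiber (lattice_points P) (image_mset f r) \<Longrightarrow> weight \<Sigma> (image_mset f r) \<le> weight \<Sigma> a"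
  shows "fiber_minimum P \<Sigma> (image_mset f m)"
proof (rule ccontr)
  have supp: "set_mset (image_mset f m) \<subseteq> lattice_points P" using fm by simp
  assume "\<not> ?thesis"
  then obtain q a where q: "q \<subseteq># image_mset f m" "size q = 2" "squarefree_monomial q"
    "a \<in> toric_fiber (lattice_points P) q" "weight \<Sigma> a < weight \<Sigma> q"
    using supp nonminimal_contains_quadratic[OF GB supp] by (fastforce simp: fiber_minimum_def)
  obtain r where r: "r \<subseteq># m" "image_mset f r = q" using subset_image_mset_obtain[OF q(1)] .
  then have "size r = 2" "squarefree_monomial r"
    using q(2,3) squarefree_monomial_image_mset[of f r] by auto
  then show False using quadratic[OF r(1)] q(4,5) r(2) by fastforce
qed

section \<open>The order on a fiber product\<close>

lemma decreasing_factorization_exists: "\<exists>xs. decreasing_factorization \<Sigma>\<^sub>1 \<Sigma>\<^sub>2 m xs"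
proof (induction "size m" arbitrary: m)
  case (Suc n)
  let ?less = "box_point_less \<Sigma>\<^sub>1 \<Sigma>\<^sub>2"
  have "asymp_on (set_mset m) ?less" "transp_on (set_mset m) ?less"
    by (auto simp: asymp_on_def transp_on_def box_point_less_def)
  moreover have "set_mset m \<noteq> {}" using Suc(2) by auto
  ultimately obtain x where x: "x \<in># m" "\<And>y. y \<in># m \<Longrightarrow> y \<noteq> x \<Longrightarrow> \<not> ?less x y"
    using Finite_Set.bex_max_element[of "set_mset m" ?less] by auto
  have "n = size (m - {#x#})" using Suc(2) x(1) by (simp add: size_Diff_singleton)
  then obtain xs where "decreasing_factorization \<Sigma>\<^sub>1 \<Sigma>\<^sub>2 (m - {#x#}) xs"
    using Suc(1) by blast
  moreover from this have "set xs \<subseteq> set_mset m"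
    by (auto simp: decreasing_factorization_def dest: in_diffD simp flip: set_mset_mset)
  ultimately have "decreasing_factorization \<Sigma>\<^sub>1 \<Sigma>\<^sub>2 m (x # xs)"
    using x by (fastforce simp: decreasing_factorization_def box_point_less_def)
  then show ?case by blast
qed (auto simp: decreasing_factorization_def)

lemma decreasing_factorization_unique:
  assumes total: "\<And>x y. x \<in># m \<Longrightarrow> y \<in># m \<Longrightarrow> x \<noteq> y \<Longrightarrow>
      box_point_less \<Sigma>\<^sub>1 \<Sigma>\<^sub>2 x y \<or> box_point_less \<Sigma>\<^sub>1 \<Sigma>\<^sub>2 y x"
    and "decreasing_factorization \<Sigma>\<^sub>1 \<Sigma>\<^sub>2 m xs" "decreasing_factorization \<Sigma>\<^sub>1 \<Sigma>\<^sub>2 m ys"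
  shows "xs = ys"
  using assms
proof (induction xs arbitrary: m ys)
  case (Cons x xs)
  then obtain y ys' where ys: "ys = y # ys'"
    by (cases ys) (auto simp: decreasing_factorization_def)
  have m: "mset (x # xs) = m" "mset (y # ys') = m"
    using Cons.prems unfolding ys decreasing_factorization_def by blast+
  then have set: "set (x # xs) = set_mset m" "set (y # ys') = set_mset m" by (metis set_mset_mset)+
  have "x = y"
  proof (rule ccontr)
    assume ne: "x \<noteq> y"
    have "y \<in> set xs" "x \<in> set ys'" using set ne by auto
    then have "\<not> box_point_less \<Sigma>\<^sub>1 \<Sigma>\<^sub>2 x y" "\<not> box_point_less \<Sigma>\<^sub>1 \<Sigma>\<^sub>2 y x"
      using Cons.prems(2,3) unfolding ys decreasing_factorization_def by auto
    moreover have "x \<in># m" "y \<in># m" using set by auto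
    ultimately show False using Cons.prems(1) ne by blast
  qed
  moreover have "xs = ys'"
  proof (rule Cons.IH[of "mset xs"])
    show "decreasing_factorization \<Sigma>\<^sub>1 \<Sigma>\<^sub>2 (mset xs) xs"
      using Cons.prems(2) by (simp add: decreasing_factorization_def)
    show "decreasing_factorization \<Sigma>\<^sub>1 \<Sigma>\<^sub>2 (mset xs) ys'"
      using Cons.prems(3) m \<open>x = y\<close> by (auto simp: decreasing_factorization_def ys)
    show "box_point_less \<Sigma>\<^sub>1 \<Sigma>\<^sub>2 x y \<or> box_point_less \<Sigma>\<^sub>1 \<Sigma>\<^sub>2 y x"
      if "x \<in># mset xs" "y \<in># mset xs" "x \<noteq> y" for x y
      using that m(1) by (intro Cons.prems(1)) auto
  qed
  ultimately show ?case by (simp add: ys)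
qed (auto simp: decreasing_factorization_def)

lemma box_point_less_total:
  assumes "inj_on \<Sigma>\<^sub>1 A" "inj_on \<Sigma>\<^sub>2 B" "x \<in> A \<times> B" "y \<in> A \<times> B" "x \<noteq> y"
  shows "box_point_less \<Sigma>\<^sub>1 \<Sigma>\<^sub>2 x y \<or> box_point_less \<Sigma>\<^sub>1 \<Sigma>\<^sub>2 y x"
  using assms unfolding box_point_less_def inj_on_def
  by (metis linorder_less_linear mem_Times_iff prod_eqI)

lemma box_less_total:
  assumes inj: "inj_on \<Sigma>\<^sub>1 A" "inj_on \<Sigma>\<^sub>2 B"
    and m: "set_mset m \<subseteq> A \<times> B" "set_mset m' \<subseteq> A \<times> B" "m \<noteq> m'"
  shows "box_less \<Sigma>\<^sub>1 \<Sigma>\<^sub>2 m m' \<or> box_less \<Sigma>\<^sub>1 \<Sigma>\<^sub>2 m' m"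
proof -
  let ?r = "{(x, y). box_point_less \<Sigma>\<^sub>1 \<Sigma>\<^sub>2 x y}"
  obtain xs ys where xs: "decreasing_factorization \<Sigma>\<^sub>1 \<Sigma>\<^sub>2 m xs" "decreasing_factorization \<Sigma>\<^sub>1 \<Sigma>\<^sub>2 m' ys"
    using decreasing_factorization_exists by metis
  have ms: "mset xs = m" "mset ys = m'" using xs by (auto simp: decreasing_factorization_def)
  have "(xs, ys) \<in> lex ?r \<or> (ys, xs) \<in> lex ?r" if "size m = size m'"
  proof -
    have "xs \<noteq> ys" "length xs = length ys" using ms m(3) that by auto
    then obtain pre x xs' y ys' where d: "x \<noteq> y" "xs = pre @ [x] @ xs'" "ys = pre @ [y] @ ys'"
      using same_length_different by metis
    have "x \<in># m" "y \<in># m'" using d ms by auto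
    then have "(x, y) \<in> ?r \<or> (y, x) \<in> ?r"
      using box_point_less_total[OF inj _ _ d(1)] m by auto
    then show ?thesis using \<open>length xs = length ys\<close> by (auto simp: d(2,3) lex_append_leftI)
  qed
  then show ?thesis unfolding box_less_def Let_def using xs by (meson linorder_less_linear)
qed

lemma box_less_asym:
  assumes inj: "inj_on \<Sigma>\<^sub>1 A" "inj_on \<Sigma>\<^sub>2 B"
    and m: "set_mset m \<subseteq> A \<times> B" "set_mset m' \<subseteq> A \<times> B"
    and less: "box_less \<Sigma>\<^sub>1 \<Sigma>\<^sub>2 m m'"
  shows "\<not> box_less \<Sigma>\<^sub>1 \<Sigma>\<^sub>2 m' m"
proof
  let ?r = "{(x, y). box_point_less \<Sigma>\<^sub>1 \<Sigma>\<^sub>2 x y}"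
  assume "box_less \<Sigma>\<^sub>1 \<Sigma>\<^sub>2 m' m"
  with less obtain xs ys xs' ys' where
    d: "decreasing_factorization \<Sigma>\<^sub>1 \<Sigma>\<^sub>2 m xs" "decreasing_factorization \<Sigma>\<^sub>1 \<Sigma>\<^sub>2 m' ys" "(xs, ys) \<in> lex ?r"
      "decreasing_factorization \<Sigma>\<^sub>1 \<Sigma>\<^sub>2 m xs'" "decreasing_factorization \<Sigma>\<^sub>1 \<Sigma>\<^sub>2 m' ys'" "(ys', xs') \<in> lex ?r"
    unfolding box_less_def Let_def by (elim disjE conjE exE) auto
  have "box_point_less \<Sigma>\<^sub>1 \<Sigma>\<^sub>2 x y \<or> box_point_less \<Sigma>\<^sub>1 \<Sigma>\<^sub>2 y x"
    if "x \<in># m \<and> y \<in># m \<or> x \<in># m' \<and> y \<in># m'" "x \<noteq> y" for x y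
    using that m by (intro box_point_less_total[OF inj]) blast+
  then have "xs = xs'" "ys = ys'"
    using d by (metis decreasing_factorization_unique)+
  moreover have "asym (lex ?r)"
    by (intro asym_lex asymI) (auto simp: box_point_less_def)
  ultimately show False using d(3,6) by (auto dest: asymD)
qed

lemma weight_prod:
  "weight (\<lambda>(V, W). \<Sigma>\<^sub>1 V + \<Sigma>\<^sub>2 W) m = weight \<Sigma>\<^sub>1 (image_mset fst m) + weight \<Sigma>\<^sub>2 (image_mset snd m)"
  by (induction m) (auto simp: weight_def)

text \<open>
  Both monomials have the same weight. Their largest factors both contain \<open>V'\<close>, with partner \<open>W\<close>
  after the swap and \<open>W'\<close> before it, and \<open>W\<close> is below \<open>W'\<close>.
\<close>

lemma swapped_pairs_box_less:
  assumes "\<Sigma>\<^sub>1 V < \<Sigma>\<^sub>1 V'" "\<Sigma>\<^sub>2 W < \<Sigma>\<^sub>2 W'"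
  shows "box_less \<Sigma>\<^sub>1 \<Sigma>\<^sub>2 {#(V, W'), (V', W)#} {#(V, W), (V', W')#}"
proof -
  have "decreasing_factorization \<Sigma>\<^sub>1 \<Sigma>\<^sub>2 {#(V, W'), (V', W)#} [(V', W), (V, W')]"
    "decreasing_factorization \<Sigma>\<^sub>1 \<Sigma>\<^sub>2 {#(V, W), (V', W')#} [(V', W'), (V, W)]"
    using assms by (auto simp: decreasing_factorization_def box_point_less_def)
  moreover have "([(V', W), (V, W')], [(V', W'), (V, W)]) \<in> lex {(x, y). box_point_less \<Sigma>\<^sub>1 \<Sigma>\<^sub>2 x y}"
    using assms by (simp add: box_point_less_def)
  ultimately show ?thesis
    unfolding box_less_def Let_def
    by (intro disjI2 conjI exI[of _ "[(V', W), (V, W')]"] exI[of _ "[(V', W'), (V, W)]"])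
      (auto simp: weight_def)
qed

lemma size_filter_mset_eq_if_image_mset_eq:
  assumes "image_mset f R = image_mset f R'"
  shows "size (filter_mset (\<lambda>z. P (f z)) R) = size (filter_mset (\<lambda>z. P (f z)) R')"
proof -
  have "size (filter_mset P (image_mset f R)) = size (filter_mset P (image_mset f R'))"
    by (simp only: assms)
  then show ?thesis by (simp add: filter_mset_image_mset)
qed

text \<open>
  Suppose that \<open>m'\<close> is smaller, and let \<open>y\<close> and \<open>x\<close> be the factors at the first place where the
  decreasing factorizations of \<open>m'\<close> and \<open>m\<close> differ. What follows the common prefix are two multisets \<open>R'\<close>
  and \<open>R\<close> with equal projections and with largest elements \<open>y\<close> and \<open>x\<close>. So \<open>y\<close> and \<open>x\<close> have the same
  first component \<open>V\<close>, and the second component of \<open>y\<close> is smaller. Call an element over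
  \<open>\<pi>\<^sub>1 V\<close> low if its second component is at most that of \<open>y\<close>; the number of low elements is the
  same in \<open>R\<close> and \<open>R'\<close>, since it depends on the second projection only. In \<open>R'\<close> all elements with first
  component \<open>V\<close> are low, since \<open>y\<close> is the largest. In \<open>R\<close> every low element has first component \<open>V\<close>, since
  larger second components go with smaller first ones, but \<open>x\<close> is not low. So \<open>R\<close> has fewer low
  elements than \<open>R'\<close>, a contradiction.
\<close>

lemma antisorted_pairing_lex_minimal:
  fixes \<Sigma>\<^sub>1 :: "'a \<Rightarrow> real" and \<Sigma>\<^sub>2 :: "'b \<Rightarrow> real"
  assumes inj: "inj_on \<Sigma>\<^sub>1 A"
    and m: "\<And>z. z \<in># m \<Longrightarrow> fst z \<in> A \<and> \<pi>\<^sub>1 (fst z) = \<pi>\<^sub>2 (snd z)"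
    and m': "\<And>z. z \<in># m' \<Longrightarrow> fst z \<in> A \<and> \<pi>\<^sub>1 (fst z) = \<pi>\<^sub>2 (snd z)"
    and marginals: "image_mset fst m' = image_mset fst m" "image_mset snd m' = image_mset snd m"
    and antisorted: "\<And>x y. x \<in># m \<Longrightarrow> y \<in># m \<Longrightarrow> \<pi>\<^sub>1 (fst x) = \<pi>\<^sub>1 (fst y) \<Longrightarrow>
      \<Sigma>\<^sub>1 (fst x) < \<Sigma>\<^sub>1 (fst y) \<Longrightarrow> \<Sigma>\<^sub>2 (snd y) \<le> \<Sigma>\<^sub>2 (snd x)"
    and xs: "decreasing_factorization \<Sigma>\<^sub>1 \<Sigma>\<^sub>2 m xs" and ys: "decreasing_factorization \<Sigma>\<^sub>1 \<Sigma>\<^sub>2 m' ys"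
  shows "(ys, xs) \<notin> lex {(x, y). box_point_less \<Sigma>\<^sub>1 \<Sigma>\<^sub>2 x y}"
proof
  assume "(ys, xs) \<in> lex {(x, y). box_point_less \<Sigma>\<^sub>1 \<Sigma>\<^sub>2 x y}"
  then obtain us x y xs' ys' where d: "ys = us @ y # ys'" "xs = us @ x # xs'"
    and yx: "box_point_less \<Sigma>\<^sub>1 \<Sigma>\<^sub>2 y x"
    unfolding lex_conv by auto
  define R where "R = mset (x # xs')"
  define R' where "R' = mset (y # ys')"
  have m_eq: "m = mset us + R" "m' = mset us + R'"
    using xs ys by (auto simp: d R_def R'_def decreasing_factorization_def)
  have marg: "image_mset fst R' = image_mset fst R" "image_mset snd R' = image_mset snd R"
    using marginals by (simp_all add: m_eq)
  have R: "\<And>z. z \<in># R \<Longrightarrow> z \<in># m" "\<And>z. z \<in># R' \<Longrightarrow> z \<in># m'" by (auto simp: m_eq)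
  have xR: "x \<in># R" by (simp add: R_def)
  have maxx: "\<not> box_point_less \<Sigma>\<^sub>1 \<Sigma>\<^sub>2 x z" if "z \<in># R" for z
    using xs that by (auto simp: d R_def decreasing_factorization_def sorted_wrt_append box_point_less_def)
  have maxy: "\<not> box_point_less \<Sigma>\<^sub>1 \<Sigma>\<^sub>2 y z" if "z \<in># R'" for z
    using ys that by (auto simp: d R'_def decreasing_factorization_def sorted_wrt_append box_point_less_def)
  have "fst x \<in># image_mset fst R'" using xR marg by simp
  then obtain z where "z \<in># R'" "fst z = fst x" by auto
  then have "\<Sigma>\<^sub>1 (fst x) \<le> \<Sigma>\<^sub>1 (fst y)" using maxy[of z] by (auto simp: box_point_less_def)
  with yx have S1: "\<Sigma>\<^sub>1 (fst y) = \<Sigma>\<^sub>1 (fst x)" and S2: "\<Sigma>\<^sub>2 (snd y) < \<Sigma>\<^sub>2 (snd x)"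
    by (auto simp: box_point_less_def)
  let ?low = "\<lambda>w. \<pi>\<^sub>2 w = \<pi>\<^sub>1 (fst x) \<and> \<Sigma>\<^sub>2 w \<le> \<Sigma>\<^sub>2 (snd y)"
  let ?top = "\<lambda>v. v = fst x"
  have low_top: "fst z = fst x" if z: "z \<in># R" "?low (snd z)" for z
  proof -
    have "\<not> \<Sigma>\<^sub>1 (fst z) < \<Sigma>\<^sub>1 (fst x)"
      using antisorted[of z x] m[of z] R z xR S2 by auto
    moreover have "\<not> \<Sigma>\<^sub>1 (fst x) < \<Sigma>\<^sub>1 (fst z)" using maxx[OF z(1)] by (auto simp: box_point_less_def)
    ultimately have "\<Sigma>\<^sub>1 (fst z) = \<Sigma>\<^sub>1 (fst x)" by simp
    then show ?thesis using inj m R z xR by (meson inj_onD)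
  qed
  obtain R\<^sub>0 where R0: "R = add_mset x R\<^sub>0" using multi_member_split[OF xR] by blast
  have "size (filter_mset (\<lambda>z. ?low (snd z)) R) = size (filter_mset (\<lambda>z. ?low (snd z)) R\<^sub>0)"
    using S2 by (simp add: R0)
  also have "\<dots> \<le> size (filter_mset (\<lambda>z. ?top (fst z)) R\<^sub>0)"
    by (intro size_mset_mono filter_mset_mono_strong subset_mset.order_refl low_top) (simp_all add: R0)
  also have "\<dots> < size (filter_mset (\<lambda>z. ?top (fst z)) R)" by (simp add: R0)
  also have "\<dots> = size (filter_mset (\<lambda>z. ?top (fst z)) R')"
    by (rule size_filter_mset_eq_if_image_mset_eq[where P = ?top]) (simp only: marg)
  also have "\<dots> \<le> size (filter_mset (\<lambda>z. ?low (snd z)) R')"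
  proof (intro size_mset_mono filter_mset_mono_strong subset_mset.order_refl)
    fix z assume z: "z \<in># R'" "?top (fst z)"
    then have "\<Sigma>\<^sub>2 (snd z) \<le> \<Sigma>\<^sub>2 (snd y)" using maxy[OF z(1)] S1 by (simp add: box_point_less_def)
    moreover have "\<pi>\<^sub>1 (fst z) = \<pi>\<^sub>2 (snd z)" using m' R(2) z(1) by blast
    ultimately show "?low (snd z)" using z(2) by simp
  qed
  also have "\<dots> = size (filter_mset (\<lambda>z. ?low (snd z)) R)"
    by (rule size_filter_mset_eq_if_image_mset_eq[where P = ?low]) (simp only: marg)
  finally show False by simp
qed

section \<open>Lifting minima to the fiber product\<close>

lemma morphism_fiber_minimum:
  assumes "morphism P \<Sigma> Q \<Gamma> \<pi>" "has_quadratic_squarefree_GB Q (weight_less \<Gamma>)" "fiber_minimum P \<Sigma> m"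
  shows "fiber_minimum Q \<Gamma> (image_mset \<pi> m)"
proof -
  have "standard_monomial P (weight_less \<Sigma>) m"
    using assms(3) by (rule fiber_minimum_imp_standard)
  then have "standard_monomial Q (weight_less \<Gamma>) (image_mset \<pi> m)"
    using assms(1) by (simp add: morphism_def)
  then show ?thesis by (rule standard_imp_fiber_minimum[OF assms(2)])
qed

text \<open>
  The minima of the two projected fibers have standard images in \<open>Q\<close>, in the same fiber because
  \<open>\<pi>\<^sub>1\<close> and \<open>\<pi>\<^sub>2\<close> agree on \<open>r\<close> and are linear. By uniqueness the images are equal, so
  the minima can be paired.
\<close>

lemma fiber_minima_lift:
  fixes P\<^sub>1 :: "'a::euclidean_space set" and P\<^sub>2 :: "'b::euclidean_space set" and Q :: "'c::euclidean_space set"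
  assumes "lattice_polytope P\<^sub>1" "lattice_polytope P\<^sub>2"
    and mor: "morphism P\<^sub>1 \<Sigma>\<^sub>1 Q \<Sigma> \<pi>\<^sub>1" "morphism P\<^sub>2 \<Sigma>\<^sub>2 Q \<Sigma> \<pi>\<^sub>2"
    and "has_quadratic_squarefree_GB P\<^sub>1 (weight_less \<Sigma>\<^sub>1)"
    and "has_quadratic_squarefree_GB P\<^sub>2 (weight_less \<Sigma>\<^sub>2)"
    and Q: "has_quadratic_squarefree_GB Q (weight_less \<Sigma>)"
    and r: "set_mset r \<subseteq> lattice_points (fiber_product P\<^sub>1 \<pi>\<^sub>1 P\<^sub>2 \<pi>\<^sub>2)"
  shows "\<exists>r'\<in>toric_fiber (lattice_points (fiber_product P\<^sub>1 \<pi>\<^sub>1 P\<^sub>2 \<pi>\<^sub>2)) r.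
    fiber_minimum P\<^sub>1 \<Sigma>\<^sub>1 (image_mset fst r') \<and> fiber_minimum P\<^sub>2 \<Sigma>\<^sub>2 (image_mset snd r')"
proof -
  have "set_mset (image_mset fst r) \<subseteq> lattice_points P\<^sub>1" "set_mset (image_mset snd r) \<subseteq> lattice_points P\<^sub>2"
    using r by (auto simp: lattice_points_fiber_product)
  then obtain a b where a: "a \<in> toric_fiber (lattice_points P\<^sub>1) (image_mset fst r)" "fiber_minimum P\<^sub>1 \<Sigma>\<^sub>1 a"
    and b: "b \<in> toric_fiber (lattice_points P\<^sub>2) (image_mset snd r)" "fiber_minimum P\<^sub>2 \<Sigma>\<^sub>2 b"
    using fiber_minimum_exists assms by meson
  have "image_mset \<pi>\<^sub>1 a = image_mset \<pi>\<^sub>2 b"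
  proof (rule fiber_minimum_unique)
    show "fiber_minimum Q \<Sigma> (image_mset \<pi>\<^sub>1 a)" "fiber_minimum Q \<Sigma> (image_mset \<pi>\<^sub>2 b)"
      using a(2) b(2) mor Q by (blast intro: morphism_fiber_minimum)+
    show "size (image_mset \<pi>\<^sub>1 a) = size (image_mset \<pi>\<^sub>2 b)"
      using a(1) b(1) by (simp add: toric_fiber_def)
    have "image_mset (\<lambda>z. \<pi>\<^sub>1 (fst z)) r = image_mset (\<lambda>z. \<pi>\<^sub>2 (snd z)) r"
      using r by (intro image_mset_cong) (auto simp: lattice_points_fiber_product)
    then have "\<Sum>\<^sub># (image_mset \<pi>\<^sub>1 (image_mset fst r)) = \<Sum>\<^sub># (image_mset \<pi>\<^sub>2 (image_mset snd r))"
      by (simp add: multiset.map_comp o_def)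
    moreover have "linear \<pi>\<^sub>1" "linear \<pi>\<^sub>2" using mor by (auto simp: morphism_def)
    ultimately show "\<Sum>\<^sub># (image_mset \<pi>\<^sub>1 a) = \<Sum>\<^sub># (image_mset \<pi>\<^sub>2 b)"
      using a(1) b(1) by (simp add: linear_sum_mset toric_fiber_def)
  qed
  then obtain r' where r': "image_mset fst r' = a" "image_mset snd r' = b"
    "\<forall>z\<in>#r'. \<pi>\<^sub>1 (fst z) = \<pi>\<^sub>2 (snd z)" using mset_fiber_product by metis
  have "size r' = size r" using a(1) r'(1) by (auto simp: toric_fiber_def)
  moreover have "fst ` set_mset r' \<subseteq> lattice_points P\<^sub>1" "snd ` set_mset r' \<subseteq> lattice_points P\<^sub>2"
    using a(1) b(1) unfolding toric_fiber_def r'(1,2)[symmetric] by simp_all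
  then have "set_mset r' \<subseteq> lattice_points (fiber_product P\<^sub>1 \<pi>\<^sub>1 P\<^sub>2 \<pi>\<^sub>2)"
    using r'(3) by (auto simp: lattice_points_fiber_product image_subset_iff)
  ultimately have "r' \<in> toric_fiber (lattice_points (fiber_product P\<^sub>1 \<pi>\<^sub>1 P\<^sub>2 \<pi>\<^sub>2)) r"
    using a(1) b(1) r'(1,2) by (simp add: toric_fiber_def sum_mset_prod)
  with a(2) b(2) r' show ?thesis by blast
qed

theorem proposition1p23:
  fixes P\<^sub>1 :: "(real ^ 'n\<^sub>1) set" and P\<^sub>2 :: "(real ^ 'n\<^sub>2) set" and Q :: "(real ^ 'k) set"
    and \<Sigma>\<^sub>1 :: "real ^ 'n\<^sub>1 \<Rightarrow> real" and \<Sigma>\<^sub>2 :: "real ^ 'n\<^sub>2 \<Rightarrow> real" and \<Sigma> :: "real ^ 'k \<Rightarrow> real"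
    and \<pi>\<^sub>1 :: "real ^ 'n\<^sub>1 \<Rightarrow> real ^ 'k" and \<pi>\<^sub>2 :: "real ^ 'n\<^sub>2 \<Rightarrow> real ^ 'k"
  assumes "lattice_polytope P\<^sub>1" and "lattice_polytope P\<^sub>2" and "lattice_polytope Q"
    and "morphism P\<^sub>1 \<Sigma>\<^sub>1 Q \<Sigma> \<pi>\<^sub>1" and "morphism P\<^sub>2 \<Sigma>\<^sub>2 Q \<Sigma> \<pi>\<^sub>2"
    and "inj_on \<Sigma>\<^sub>1 (lattice_points P\<^sub>1)" and "inj_on \<Sigma>\<^sub>2 (lattice_points P\<^sub>2)"
    and "has_quadratic_squarefree_GB P\<^sub>1 (weight_less \<Sigma>\<^sub>1)"
    and "has_quadratic_squarefree_GB P\<^sub>2 (weight_less \<Sigma>\<^sub>2)"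
    and "has_quadratic_squarefree_GB Q (weight_less \<Sigma>)"
  shows "has_quadratic_squarefree_GB (fiber_product P\<^sub>1 \<pi>\<^sub>1 P\<^sub>2 \<pi>\<^sub>2) (box_less \<Sigma>\<^sub>1 \<Sigma>\<^sub>2)"
proof (rule has_quadratic_squarefree_GB_if_total)
  let ?S = "lattice_points (fiber_product P\<^sub>1 \<pi>\<^sub>1 P\<^sub>2 \<pi>\<^sub>2)"
  let ?S1 = "lattice_points P\<^sub>1" and ?S2 = "lattice_points P\<^sub>2"
  let ?less = "box_less \<Sigma>\<^sub>1 \<Sigma>\<^sub>2"
  note inj = \<open>inj_on \<Sigma>\<^sub>1 ?S1\<close> \<open>inj_on \<Sigma>\<^sub>2 ?S2\<close>
  note lift = fiber_minima_lift[OF assms(1,2,4,5,8-10)]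
  have S: "?S \<subseteq> ?S1 \<times> ?S2" by (auto simp: lattice_points_fiber_product)
  show "?less m m' \<or> ?less m' m" if "set_mset m \<subseteq> ?S" "set_mset m' \<subseteq> ?S" "m \<noteq> m'" for m m'
    using box_less_total[OF inj] that S by blast
  show "\<not> ?less m' m" if "set_mset m \<subseteq> ?S" "set_mset m' \<subseteq> ?S" "?less m m'" for m m'
    using box_less_asym[OF inj] that S by blast
  have fibers: "image_mset fst r' \<in> toric_fiber ?S1 (image_mset fst r)"
    "image_mset snd r' \<in> toric_fiber ?S2 (image_mset snd r)" "size r' = size r"
    if "r' \<in> toric_fiber ?S r" for r r'
    using that S by (auto simp: toric_fiber_def sum_mset_prod)
  fix m m'
  assume m: "set_mset m \<subseteq> ?S" and m': "m' \<in> toric_fiber ?S m" and less: "?less m' m"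
  show "\<exists>q. q \<subseteq># m \<and> size q = 2 \<and> squarefree_monomial q \<and> (\<exists>q'\<in>toric_fiber ?S q. ?less q' q)"
  proof (rule ccontr)
    assume no: "\<not> ?thesis"
    have sub: "set_mset r \<subseteq> ?S" if "r \<subseteq># m" for r
      using m that by (meson order_trans set_mset_mono)
    \<comment> \<open>Otherwise pairing the two minima would give a lighter monomial in the fiber of \<open>r\<close>.\<close>
    have pair_min: "(\<forall>a\<in>toric_fiber ?S1 (image_mset fst r). weight \<Sigma>\<^sub>1 (image_mset fst r) \<le> weight \<Sigma>\<^sub>1 a) \<and>
        (\<forall>b\<in>toric_fiber ?S2 (image_mset snd r). weight \<Sigma>\<^sub>2 (image_mset snd r) \<le> weight \<Sigma>\<^sub>2 b)"
      if r: "r \<subseteq># m" "size r = 2" "squarefree_monomial r" for r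
    proof -
      obtain r' where r': "r' \<in> toric_fiber ?S r"
        "fiber_minimum P\<^sub>1 \<Sigma>\<^sub>1 (image_mset fst r')" "fiber_minimum P\<^sub>2 \<Sigma>\<^sub>2 (image_mset snd r')"
        using lift[OF sub[OF r(1)]] by blast
      have "toric_fiber ?S1 (image_mset fst r') = toric_fiber ?S1 (image_mset fst r)"
        "toric_fiber ?S2 (image_mset snd r') = toric_fiber ?S2 (image_mset snd r)"
        using fibers[OF r'(1)] by (auto simp: toric_fiber_def)
      then have le: "weight \<Sigma>\<^sub>1 (image_mset fst r') \<le> weight \<Sigma>\<^sub>1 a" "weight \<Sigma>\<^sub>2 (image_mset snd r') \<le> weight \<Sigma>\<^sub>2 b"
        if "a \<in> toric_fiber ?S1 (image_mset fst r)" "b \<in> toric_fiber ?S2 (image_mset snd r)" for a b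
        using fiber_minimum_le r'(2,3) that by metis+
      have self: "image_mset fst r \<in> toric_fiber ?S1 (image_mset fst r)"
        "image_mset snd r \<in> toric_fiber ?S2 (image_mset snd r)"
        using sub[OF r(1)] S by (auto simp: toric_fiber_def)
      have "\<not> ?less r' r" using no r r'(1) by blast
      then have "weight \<Sigma>\<^sub>1 (image_mset fst r) + weight \<Sigma>\<^sub>2 (image_mset snd r)
          \<le> weight \<Sigma>\<^sub>1 (image_mset fst r') + weight \<Sigma>\<^sub>2 (image_mset snd r')"
        using fibers(3)[OF r'(1)] by (simp add: box_less_def weight_prod not_less)
      then show ?thesis using le self by fastforce
    qed
    have min1: "fiber_minimum P\<^sub>1 \<Sigma>\<^sub>1 (image_mset fst m)"
      by (rule fiber_minimum_image_if_quadratic[OF assms(8)]) (use m S pair_min in auto)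
    have min2: "fiber_minimum P\<^sub>2 \<Sigma>\<^sub>2 (image_mset snd m)"
      by (rule fiber_minimum_image_if_quadratic[OF assms(9)]) (use m S pair_min in auto)
    \<comment> \<open>Neither weight can drop below that of \<open>m\<close>, so \<open>m'\<close> can be smaller only by the tie-break.\<close>
    have le: "weight \<Sigma>\<^sub>1 (image_mset fst m) \<le> weight \<Sigma>\<^sub>1 (image_mset fst m')"
      "weight \<Sigma>\<^sub>2 (image_mset snd m) \<le> weight \<Sigma>\<^sub>2 (image_mset snd m')"
      using fiber_minimum_le min1 min2 fibers[OF m'] by blast+
    then obtain xs ys where xy: "decreasing_factorization \<Sigma>\<^sub>1 \<Sigma>\<^sub>2 m xs" "decreasing_factorization \<Sigma>\<^sub>1 \<Sigma>\<^sub>2 m' ys"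
        "(ys, xs) \<in> lex {(x, y). box_point_less \<Sigma>\<^sub>1 \<Sigma>\<^sub>2 x y}"
      and eq: "weight \<Sigma>\<^sub>1 (image_mset fst m') = weight \<Sigma>\<^sub>1 (image_mset fst m)"
        "weight \<Sigma>\<^sub>2 (image_mset snd m') = weight \<Sigma>\<^sub>2 (image_mset snd m)"
      using less fibers(3)[OF m'] by (auto simp: box_less_def weight_prod)
    have marginals: "image_mset fst m' = image_mset fst m" "image_mset snd m' = image_mset snd m"
      using min1 min2 fibers[OF m'] eq unfolding fiber_minimum_def by fastforce+
    have "(ys, xs) \<notin> lex {(x, y). box_point_less \<Sigma>\<^sub>1 \<Sigma>\<^sub>2 x y}"
    proof (rule antisorted_pairing_lex_minimal[OF inj(1) _ _ marginals _ xy(1,2)])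
      show "fst z \<in> ?S1 \<and> \<pi>\<^sub>1 (fst z) = \<pi>\<^sub>2 (snd z)" if "z \<in># m" for z
        using that m by (auto simp: lattice_points_fiber_product)
      show "fst z \<in> ?S1 \<and> \<pi>\<^sub>1 (fst z) = \<pi>\<^sub>2 (snd z)" if "z \<in># m'" for z
        using that m' by (auto simp: lattice_points_fiber_product toric_fiber_def)
      fix x y
      assume x: "x \<in># m" and y: "y \<in># m" and base: "\<pi>\<^sub>1 (fst x) = \<pi>\<^sub>1 (fst y)"
        and lt: "\<Sigma>\<^sub>1 (fst x) < \<Sigma>\<^sub>1 (fst y)"
      show "\<Sigma>\<^sub>2 (snd y) \<le> \<Sigma>\<^sub>2 (snd x)"
      proof (rule ccontr)
        assume "\<not> ?thesis"
        then have "?less {#(fst x, snd y), (fst y, snd x)#} {#x, y#}"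
          using swapped_pairs_box_less[of \<Sigma>\<^sub>1 "fst x" "fst y" \<Sigma>\<^sub>2 "snd x" "snd y"] lt by simp
        moreover have "{#(fst x, snd y), (fst y, snd x)#} \<in> toric_fiber ?S {#x, y#}"
          using x y base m by (auto simp: toric_fiber_def lattice_points_fiber_product prod_eq_iff)
        moreover have "x \<noteq> y" using lt by auto
        then have "squarefree_monomial {#x, y#}" by (auto simp: squarefree_monomial_def)
        moreover have "{#x, y#} \<subseteq># m"
          using x y \<open>x \<noteq> y\<close> by (auto simp: insert_subset_eq_iff in_diff_count)
        moreover have "size {#x, y#} = 2" by simp
        ultimately show False using no by blast
      qed
    qed
    with xy(3) show False by blast
  qed
qed

end
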